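(* Let $\alpha,\gamma,\kappa,\delta,\bar S>0$, let $\beta=1$, and suppose $\alpha\ge\alpha_2:=2\gamma+\kappa\bar S/(\delta+\kappa)$ (so that the optimal policy reaches full automation). Let $V$ be the value function, $u^*$ the optimal usage policy and $\hat S$ the steady-state skill under $u^*$. Define $\alpha_3:=\gamma+\bar S$. Then: 1. If $\alpha_2\le\alpha<\alpha_3$, the optimal policy is $u^*=1$. Skill erodes to zero, and AI raises current productivity but yields a lower long-run value than the no-AI benchmark: $V(\hat S)<\bar S/\delta$. At $\alpha=\alpha_3$ full automation breaks even: $V(\hat S)=\bar S/\delta$. 2. If $\alpha>\max\{\alpha_2,\alpha_3\}$, full automation ($u^*=1$) improves both short-run flow productivity and long-run value: $V(\hat S)>\bar S/\delta$.
   Context: A worker has skill $S_t\in[0,\bar S]$; a decision-maker chooses AI usage $u_t\in[0,1]$. Flow productivity is $p(S,u)=(1-u)S+[\alpha+\beta S-\gamma u]u$. Skill evolves by $\dot S_t=\kappa\bar S(1-u_t)-\kappa S_t$. The value function is $$V(S_0)=\max_{u_t\in[0,1]}\int_0^\infty e^{-\delta t}p(S_t,u_t)\,dt,$$ with Bellman equation $\delta V(S)=\max_{u\in[0,1]}\{p(S,u)+V'(S)[\kappa\bar S(1-u)-\kappa S]\}$; $u^*$ denotes the maximizing usage, and $\hat S=\bar S(1-u^* )$ when $u^*$ is constant. The no-AI benchmark is $\bar S/\delta$. "Raises current (short-run flow) productivity" means $p(S,u^* )>p(S,0)=S$ at the current skill $S$. *)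

theory Defs
  imports "HOL-Analysis.Analysis"
begin

definition productivity :: "real \<Rightarrow> real \<Rightarrow> real \<Rightarrow> real \<Rightarrow> real \<Rightarrow> real" where
  "productivity \<alpha> \<beta> \<gamma> S u = (1 - u) * S + (\<alpha> + \<beta> * S - \<gamma> * u) * u"

definition skill_drift :: "real \<Rightarrow> real \<Rightarrow> real \<Rightarrow> real \<Rightarrow> real" where
  "skill_drift \<kappa> Sbar S u = \<kappa> * Sbar * (1 - u) - \<kappa> * S"

text \<open>
  A plan is a usage path \<open>u\<close> together with the skill path \<open>S\<close> it generates from \<open>S0\<close>.
  Usage paths are Lebesgue measurable, so the law of motion is imposed in integrated
  (Caratheodory) form; the case \<open>t = 0\<close> gives \<open>S 0 = S0\<close>. The bound on \<open>S\<close> restates the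
  skill range; it does not restrict \<open>u\<close>, since the dynamics leave \<open>{0..Sbar}\<close> invariant.
\<close>
definition admissible_plan ::
    "real \<Rightarrow> real \<Rightarrow> real \<Rightarrow> (real \<Rightarrow> real) \<Rightarrow> (real \<Rightarrow> real) \<Rightarrow> bool" where
  "admissible_plan \<kappa> Sbar S0 u S \<longleftrightarrow>
     u \<in> borel_measurable (lebesgue_on {0..}) \<and>
     (\<forall>t\<ge>0. u t \<in> {0..1} \<and> S t \<in> {0..Sbar}) \<and>
     (\<forall>t\<ge>0. ((\<lambda>s. skill_drift \<kappa> Sbar (S s) (u s)) has_integral (S t - S0)) {0..t})"

definition payoff ::
    "real \<Rightarrow> real \<Rightarrow> real \<Rightarrow> real \<Rightarrow> (real \<Rightarrow> real) \<Rightarrow> (real \<Rightarrow> real) \<Rightarrow> real" where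
  "payoff \<alpha> \<beta> \<gamma> \<delta> u S =
     integral {0..} (\<lambda>t. exp (- \<delta> * t) * productivity \<alpha> \<beta> \<gamma> (S t) (u t))"

text \<open>
  The supremum is meaningful for \<open>S0\<close> in \<open>{0..Sbar}\<close>; that it is attained is
  the existence of an \<open>optimal_plan\<close>.
\<close>
definition skill_value ::
    "real \<Rightarrow> real \<Rightarrow> real \<Rightarrow> real \<Rightarrow> real \<Rightarrow> real \<Rightarrow> real \<Rightarrow> real" where
  "skill_value \<alpha> \<beta> \<gamma> \<kappa> \<delta> Sbar S0 =
     Sup {payoff \<alpha> \<beta> \<gamma> \<delta> u S | u S. admissible_plan \<kappa> Sbar S0 u S}"

definition optimal_plan ::
    "real \<Rightarrow> real \<Rightarrow> real \<Rightarrow> real \<Rightarrow> real \<Rightarrow> real \<Rightarrow> real \<Rightarrow>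
     (real \<Rightarrow> real) \<Rightarrow> (real \<Rightarrow> real) \<Rightarrow> bool" where
  "optimal_plan \<alpha> \<beta> \<gamma> \<kappa> \<delta> Sbar S0 u S \<longleftrightarrow>
     admissible_plan \<kappa> Sbar S0 u S \<and>
     (\<forall>u' S'. admissible_plan \<kappa> Sbar S0 u' S' \<longrightarrow>
        payoff \<alpha> \<beta> \<gamma> \<delta> u' S' \<le> payoff \<alpha> \<beta> \<gamma> \<delta> u S)"

definition bellman_objective ::
    "real \<Rightarrow> real \<Rightarrow> real \<Rightarrow> real \<Rightarrow> real \<Rightarrow> real \<Rightarrow> real \<Rightarrow> real \<Rightarrow> real" where
  "bellman_objective \<alpha> \<beta> \<gamma> \<kappa> Sbar D S u =
     productivity \<alpha> \<beta> \<gamma> S u + D * skill_drift \<kappa> Sbar S u"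

text \<open>
  A feedback policy (usage as a function of current skill) is optimal if the value function
  satisfies the Bellman equation on \<open>{0..Sbar}\<close> and the policy attains the maximum in it.
  The derivative is one-sided at the two endpoints.
\<close>
definition optimal_policy ::
    "real \<Rightarrow> real \<Rightarrow> real \<Rightarrow> real \<Rightarrow> real \<Rightarrow> real \<Rightarrow> (real \<Rightarrow> real) \<Rightarrow> bool" where
  "optimal_policy \<alpha> \<beta> \<gamma> \<kappa> \<delta> Sbar ustar \<longleftrightarrow>
     (\<forall>S\<in>{0..Sbar}. \<exists>D.
        (skill_value \<alpha> \<beta> \<gamma> \<kappa> \<delta> Sbar has_real_derivative D) (at S within {0..Sbar}) \<and>
        is_arg_max (bellman_objective \<alpha> \<beta> \<gamma> \<kappa> Sbar D S) (\<lambda>u. u \<in> {0..1}) (ustar S) \<and>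
        \<delta> * skill_value \<alpha> \<beta> \<gamma> \<kappa> \<delta> Sbar S =
          bellman_objective \<alpha> \<beta> \<gamma> \<kappa> Sbar D S (ustar S))"

text \<open>For a constant policy \<open>u\<close> this says \<open>Shat = Sbar * (1 - u)\<close>.\<close>
definition steady_skill :: "real \<Rightarrow> real \<Rightarrow> (real \<Rightarrow> real) \<Rightarrow> real \<Rightarrow> bool" where
  "steady_skill \<kappa> Sbar ustar Shat \<longleftrightarrow>
     Shat \<in> {0..Sbar} \<and> skill_drift \<kappa> Sbar Shat (ustar Shat) = 0"

end

theory Submission
  imports Defs
begin

text \<open>
  For \<open>\<beta> = 1\<close> the flow \<open>S + \<alpha> u - \<gamma> u\<^sup>2\<close> is linear in skill, and discounting the law of motion
  over an infinite horizon expresses \<open>\<integral> exp (- \<delta> t) S\<close> through \<open>S0\<close> and \<open>u\<close> alone: skill has the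
  constant shadow price \<open>1 / (\<delta> + \<kappa>)\<close>. Hence the payoff of every plan falls short of
  \<open>S0 / (\<delta> + \<kappa>) + (\<alpha> - \<gamma>) / \<delta>\<close> by the discounted integral of a pointwise loss, which above the
  threshold is at least \<open>\<gamma> (1 - u)\<^sup>2\<close>. So \<open>u = 1\<close> almost everywhere is the only optimum, the value
  function is affine, and \<open>V 0 = (\<alpha> - \<gamma>) / \<delta>\<close>.
\<close>

section \<open>Integration by parts for primitives of bounded functions\<close>

text \<open>The difference quotient at \<open>x\<close> is at most
  \<open>C * \<bar>y - x\<bar>\<close>, so the derivative exists and vanishes. No differentiability
  has to be known beforehand, which is what makes this usable for functions built from skill
  paths.\<close>

lemma constant_if_quadratic_increments:
  fixes f :: "real \<Rightarrow> real"
  assumes "\<And>x y. a \<le> x \<Longrightarrow> x \<le> y \<Longrightarrow> y \<le> b \<Longrightarrow> \<bar>f y - f x\<bar> \<le> C * (y - x)\<^sup>2"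
    and "x \<in> {a..b}" "y \<in> {a..b}"
  shows "f x = f y"
proof -
  have inc: "\<bar>f y - f x\<bar> \<le> C * (y - x)\<^sup>2" if "x \<in> {a..b}" "y \<in> {a..b}" for x y
    using assms(1)[of x y] assms(1)[of y x] that
    by (cases "x \<le> y") (auto simp: abs_minus_commute power2_commute)
  have "(f has_field_derivative 0) (at x within {a..b})" if x: "x \<in> {a..b}" for x
  proof -
    have "((\<lambda>y. C * \<bar>y - x\<bar>) \<longlongrightarrow> 0) (at x within {a..b})"
      by (rule tendsto_eq_intros refl | simp)+
    moreover have "\<forall>\<^sub>F y in at x within {a..b}. norm ((f y - f x) / (y - x)) \<le> C * \<bar>y - x\<bar>"
      unfolding eventually_at_filter
    proof (intro always_eventually allI impI)
      fix y assume "y \<noteq> x" "y \<in> {a..b}"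
      then show "norm ((f y - f x) / (y - x)) \<le> C * \<bar>y - x\<bar>"
        using inc[OF x, of y] by (simp add: field_simps power2_eq_square abs_mult_self_eq)
    qed
    ultimately show ?thesis
      unfolding has_field_derivative_iff by (rule Lim_null_comparison[rotated])
  qed
  then show ?thesis
    using has_field_derivative_zero_constant[of "{a..b}" f] assms(2,3) by fastforce
qed

lemma has_integral_primitive_diff:
  fixes g G :: "real \<Rightarrow> real"
  assumes "a \<le> x" "x \<le> y"
    and gx: "(g has_integral (G x - G a)) {a..x}" and gy: "(g has_integral (G y - G a)) {a..y}"
  shows "(g has_integral (G y - G x)) {x..y}"
proof -
  have "g integrable_on {x..y}"
    using gy \<open>a \<le> x\<close> by (auto intro: integrable_on_subinterval)
  then have gi: "(g has_integral integral {x..y} g) {x..y}"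
    by blast
  have "(g has_integral ((G x - G a) + integral {x..y} g)) {a..y}"
    using assms(1,2) gx gi by (rule has_integral_combine)
  then have "G y - G a = (G x - G a) + integral {x..y} g"
    using gy by (intro has_integral_unique)
  with gi show ?thesis
    by (simp add: algebra_simps)
qed

text \<open>The condition on \<open>T\<close> describes an interval with left end \<open>a\<close>,
  bounded or not: the product rule uses \<open>{a..b}\<close>, the measurability of skill paths uses
  \<open>{0..}\<close>.\<close>

lemma lipschitz_on_primitive:
  fixes g G :: "real \<Rightarrow> real"
  assumes T: "\<And>t. t \<in> T \<Longrightarrow> a \<le> t \<and> {a..t} \<subseteq> T"
    and g: "\<And>t. t \<in> T \<Longrightarrow> (g has_integral (G t - G a)) {a..t}"
    and B: "\<And>t. t \<in> T \<Longrightarrow> \<bar>g t\<bar> \<le> B" and "B \<ge> 0"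
  shows "B-lipschitz_on T G"
proof (rule lipschitz_onI)
  have le: "\<bar>G y - G x\<bar> \<le> B * (y - x)" if "x \<in> T" "y \<in> T" "x \<le> y" for x y
  proof -
    have "(g has_integral (G y - G x)) {x..y}"
      using T[OF that(1)] that by (intro has_integral_primitive_diff[of a x y g G, OF _ _ g g]) simp_all
    moreover have "norm (g s) \<le> B" if s: "s \<in> {x..y} - {}" for s
    proof -
      have "s \<in> T"
        using T[OF \<open>x \<in> T\<close>] T[OF \<open>y \<in> T\<close>] s by auto
      then show ?thesis
        using B by simp
    qed
    ultimately have "norm (G y - G x) \<le> B * measure lborel {x..y}"
      by (rule has_integral_bound_real[OF \<open>B \<ge> 0\<close> finite.emptyI])
    then show ?thesis
      using \<open>x \<le> y\<close> by simp
  qed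
  show "dist (G x) (G y) \<le> B * dist x y" if "x \<in> T" "y \<in> T" for x y
    using le[of x y] le[of y x] that
    by (cases "x \<le> y") (auto simp: dist_real_def abs_minus_commute)
qed fact

text \<open>
  Skill paths are differentiable only almost everywhere, so the library's integration by parts
  does not apply. Instead the difference of both sides has increments of second order.
\<close>
lemma has_integral_product_rule:
  fixes \<phi> \<phi>' g G :: "real \<Rightarrow> real"
  assumes "a \<le> b"
    and der: "\<And>t. t \<in> {a..b} \<Longrightarrow> (\<phi> has_real_derivative \<phi>' t) (at t within {a..b})"
    and cont: "continuous_on {a..b} \<phi>'"
    and g: "\<And>t. t \<in> {a..b} \<Longrightarrow> (g has_integral (G t - G a)) {a..t}"
    and B: "\<And>t. t \<in> {a..b} \<Longrightarrow> \<bar>g t\<bar> \<le> B"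
  shows "((\<lambda>t. \<phi> t * g t + \<phi>' t * G t) has_integral (\<phi> b * G b - \<phi> a * G a)) {a..b}"
proof -
  have "B \<ge> 0"
    using B[of a] \<open>a \<le> b\<close> by force
  have g_sub: "(g has_integral (G y - G x)) {x..y}" if "a \<le> x" "x \<le> y" "y \<le> b" for x y
    using that by (intro has_integral_primitive_diff[of a x y g G, OF _ _ g g]) simp_all
  have G: "B-lipschitz_on {a..b} G"
    using g B \<open>B \<ge> 0\<close> by (intro lipschitz_on_primitive[of _ a g]) auto
  then have G_lip: "\<bar>G y - G x\<bar> \<le> B * (y - x)" if "a \<le> x" "x \<le> y" "y \<le> b" for x y
    using lipschitz_onD[OF G, of x y] that by (auto simp: dist_real_def abs_minus_commute)
  have "continuous_on {a..b} G"
    using G by (rule lipschitz_on_continuous_on)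
  have cont_\<phi>: "continuous_on {a..b} \<phi>"
    using der DERIV_continuous by (fastforce simp: continuous_on_eq_continuous_within)
  have "bounded (\<phi>' ` {a..b})"
    by (intro compact_imp_bounded compact_continuous_image cont) simp
  then obtain L where L: "\<And>t. t \<in> {a..b} \<Longrightarrow> \<bar>\<phi>' t\<bar> \<le> L"
    unfolding bounded_iff by (metis image_eqI real_norm_def)
  then have "L \<ge> 0"
    using \<open>a \<le> b\<close> by force
  have \<phi>_lip: "\<bar>\<phi> y - \<phi> x\<bar> \<le> L * \<bar>y - x\<bar>" if "x \<in> {a..b}" "y \<in> {a..b}" for x y
    using field_differentiable_bound[of "{a..b}" \<phi> \<phi>' L x y] der L that
    by (auto simp: abs_minus_commute)
  \<comment> \<open>Gauge integrability alone does not in general survive multiplication by a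
    continuous function. Boundedness upgrades \<open>g\<close> to absolute integrability, which
    survives any bounded measurable factor.\<close>
  have "g absolutely_integrable_on {a..b}"
    using g[of b] B \<open>a \<le> b\<close>
    by (intro absolutely_integrable_integrable_bound[where g = "\<lambda>_. B"]) auto
  then have "(\<lambda>t. \<phi> t * g t) absolutely_integrable_on {a..b}"
    by (intro absolutely_integrable_bounded_measurable_product_real
        continuous_imp_measurable_on_sets_lebesgue cont_\<phi>
        compact_imp_bounded compact_continuous_image) auto
  then have "(\<lambda>t. \<phi> t * g t) integrable_on {a..b}"
    using absolutely_integrable_on_def by blast
  moreover have "(\<lambda>t. \<phi>' t * G t) integrable_on {a..b}"
    by (intro integrable_continuous_real continuous_intros cont \<open>continuous_on {a..b} G\<close>)
  ultimately have int: "(\<lambda>t. \<phi> t * g t + \<phi>' t * G t) integrable_on {a..b}"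
    by (rule integrable_add)
  define h where "h = (\<lambda>t. \<phi> t * g t + \<phi>' t * G t)"
  define D where "D = (\<lambda>t. \<phi> t * G t - integral {a..t} h)"
  have "\<bar>D y - D x\<bar> \<le> (2 * L * B) * (y - x)\<^sup>2" if xy: "a \<le> x" "x \<le> y" "y \<le> b" for x y
  proof -
    have hi: "h integrable_on {p..q}" if "a \<le> p" "q \<le> b" for p q
      using integrable_on_subinterval[OF int] that by (auto simp: h_def)
    have "integral {a..y} h = integral {a..x} h + integral {x..y} h"
      using hi[of a y] xy by (simp add: Henstock_Kurzweil_Integration.integral_combine)
    \<comment> \<open>The increment of \<open>\<phi> * G\<close> splits exactly into one term with
      \<open>\<phi>\<close> frozen at \<open>y\<close> and one with \<open>G\<close> frozen at
      \<open>x\<close>. Each is the integral of a simple integrand, to be compared with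
      \<open>h\<close>.\<close>
    then have "\<phi> y * (G y - G x) + (\<phi> y - \<phi> x) * G x - integral {x..y} h = D y - D x"
      by (simp add: D_def algebra_simps)
    moreover have h: "(h has_integral integral {x..y} h) {x..y}"
      using hi xy by blast
    have g: "((\<lambda>s. \<phi> y * g s) has_integral (\<phi> y * (G y - G x))) {x..y}"
      by (intro has_integral_mult_right g_sub xy)
    have \<phi>': "((\<lambda>s. \<phi>' s * G x) has_integral ((\<phi> y - \<phi> x) * G x)) {x..y}"
      using xy by (intro has_integral_mult_left fundamental_theorem_of_calculus)
        (auto simp flip: has_real_derivative_iff_has_vector_derivative
              intro: DERIV_subset[OF der])
    ultimately have "((\<lambda>s. \<phi> y * g s + \<phi>' s * G x - h s) has_integral (D y - D x)) {x..y}"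
      using has_integral_diff[OF has_integral_add[OF g \<phi>'] h] by simp
    then have "norm (D y - D x) \<le> 2 * L * B * (y - x) * measure lborel {x..y}"
    proof (rule has_integral_bound_real[rotated 2])
      fix s assume "s \<in> {x..y} - {}"
      then have s: "x \<le> s" "s \<le> y"
        by auto
      \<comment> \<open>Each of the two freezing errors is at most \<open>L * B * (y - x)\<close>,
        whence the factor 2; integrating over \<open>{x..y}\<close> supplies the second factor
        \<open>y - x\<close>.\<close>
      have "\<phi> y * g s + \<phi>' s * G x - h s = (\<phi> y - \<phi> s) * g s - \<phi>' s * (G s - G x)"
        by (simp add: h_def algebra_simps)
      moreover have "\<bar>(\<phi> y - \<phi> s) * g s\<bar> \<le> (L * (y - x)) * B"
        unfolding abs_mult using \<phi>_lip[of s y] xy s B \<open>L \<ge> 0\<close>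
        by (intro mult_mono) (auto intro: order_trans[OF _ mult_left_mono])
      moreover have "\<bar>\<phi>' s * (G s - G x)\<bar> \<le> L * (B * (y - x))"
        unfolding abs_mult using G_lip[of x s] xy s L \<open>L \<ge> 0\<close> \<open>B \<ge> 0\<close>
        by (intro mult_mono) (auto intro: order_trans[OF _ mult_left_mono])
      ultimately have "\<bar>\<phi> y * g s + \<phi>' s * G x - h s\<bar> \<le> L * (y - x) * B + L * (B * (y - x))"
        by linarith
      then show "norm (\<phi> y * g s + \<phi>' s * G x - h s) \<le> 2 * L * B * (y - x)"
        by (simp add: algebra_simps)
    qed (use \<open>L \<ge> 0\<close> \<open>B \<ge> 0\<close> xy in auto)
    then show ?thesis
      using xy by (simp add: power2_eq_square)
  qed
  from constant_if_quadratic_increments[OF this, of a b] have "D a = D b"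
    using \<open>a \<le> b\<close> by simp
  then have "integral {a..b} h = \<phi> b * G b - \<phi> a * G a"
    by (simp add: D_def)
  then show ?thesis
    using int unfolding h_def by (simp add: has_integral_iff)
qed

section \<open>Skill paths of admissible plans and their discounted integrals\<close>

text \<open>The drift is \<kappa> times the difference of two points of \<open>{0..Sbar}\<close>,
  the target \<open>Sbar * (1 - u)\<close> and the current skill.\<close>

lemma abs_skill_drift_le:
  assumes "\<kappa> \<ge> 0" "u \<in> {0..1}" "S \<in> {0..Sbar}"
  shows "\<bar>skill_drift \<kappa> Sbar S u\<bar> \<le> \<kappa> * Sbar"
proof -
  have "Sbar * (1 - u) \<le> Sbar" "0 \<le> Sbar * (1 - u)"
    using assms by (auto intro: mult_left_le)
  then have "\<bar>Sbar * (1 - u) - S\<bar> \<le> Sbar"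
    using assms(3) unfolding atLeastAtMost_iff by linarith
  then have "\<kappa> * \<bar>Sbar * (1 - u) - S\<bar> \<le> \<kappa> * Sbar"
    using assms by (intro mult_left_mono) auto
  moreover have "skill_drift \<kappa> Sbar S u = \<kappa> * (Sbar * (1 - u) - S)"
    by (simp add: skill_drift_def algebra_simps)
  ultimately show ?thesis
    using \<open>\<kappa> \<ge> 0\<close> by (simp add: abs_mult)
qed

lemma admissible_plan_start:
  assumes "admissible_plan \<kappa> Sbar S0 u S"
  shows "S 0 = S0" "S0 \<in> {0..Sbar}"
proof -
  have "((\<lambda>s. skill_drift \<kappa> Sbar (S s) (u s)) has_integral (S 0 - S0)) {0..0}"
    using assms unfolding admissible_plan_def by blast
  then show "S 0 = S0"
    by (simp add: has_integral_refl has_integral_iff)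
  then show "S0 \<in> {0..Sbar}"
    using assms unfolding admissible_plan_def by force
qed

text \<open>Two rates matter: \<open>c = - \<delta>\<close> discounts the law of motion, and
  \<open>c = \<kappa>\<close> is the integrating factor that solves it under full
  automation.\<close>

lemma admissible_plan_exp:
  assumes adm: "admissible_plan \<kappa> Sbar S0 u S" and "\<kappa> \<ge> 0" "t \<ge> 0"
  shows "((\<lambda>s. exp (c * s) * (skill_drift \<kappa> Sbar (S s) (u s) + c * S s))
           has_integral (exp (c * t) * S t - S0)) {0..t}"
proof -
  have "((\<lambda>s. exp (c * s) * skill_drift \<kappa> Sbar (S s) (u s) + (c * exp (c * s)) * S s)
          has_integral (exp (c * t) * S t - exp (c * 0) * S 0)) {0..t}"
    using adm admissible_plan_start(1)[OF adm] assms(2,3) unfolding admissible_plan_def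
    by (intro has_integral_product_rule[where B = "\<kappa> * Sbar"] abs_skill_drift_le)
      (auto intro!: derivative_eq_intros continuous_intros)
  then show ?thesis
    by (simp add: admissible_plan_start(1)[OF adm] algebra_simps)
qed

lemma tendsto_exp_discount:
  assumes "(c::real) > 0"
  shows "((\<lambda>t. exp (- c * t)) \<longlongrightarrow> 0) at_top"
proof -
  have "filterlim (\<lambda>t. - c * t) at_bot at_top"
    using assms by (intro filterlim_tendsto_neg_mult_at_bot[OF tendsto_const] filterlim_ident) auto
  then show ?thesis
    by (rule filterlim_compose[OF exp_at_bot])
qed

text \<open>Admissibility asks for measurability of usage only. Skill is the primitive of a bounded
  drift, hence Lipschitz and continuous.\<close>

lemma admissible_plan_skill_measurable:
  assumes adm: "admissible_plan \<kappa> Sbar S0 u S" and "\<kappa> \<ge> 0" "Sbar \<ge> 0"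
  shows "S \<in> borel_measurable (lebesgue_on {0..})"
proof -
  have "(\<kappa> * Sbar)-lipschitz_on {0..} S"
    using adm admissible_plan_start(1)[OF adm] assms(2,3) unfolding admissible_plan_def
    by (intro lipschitz_on_primitive[of _ 0 "\<lambda>s. skill_drift \<kappa> Sbar (S s) (u s)"]
        abs_skill_drift_le) auto
  then show ?thesis
    by (intro continuous_imp_measurable_on_sets_lebesgue lipschitz_on_continuous_on) auto
qed

lemma absolutely_integrable_exp_discount:
  fixes f :: "real \<Rightarrow> real"
  assumes "f \<in> borel_measurable (lebesgue_on {0..})" "\<And>t. t \<ge> 0 \<Longrightarrow> \<bar>f t\<bar> \<le> B" "\<delta> > 0"
  shows "(\<lambda>t. exp (- \<delta> * t) * f t) absolutely_integrable_on {0..}"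
proof -
  have "(\<lambda>t. exp (- \<delta> * t)) absolutely_integrable_on {0..}"
    using integrable_on_exp_minus_to_infinity[OF \<open>\<delta> > 0\<close>, of 0]
    by (intro nonnegative_absolutely_integrable_1) auto
  then have "(\<lambda>t. f t * exp (- \<delta> * t)) absolutely_integrable_on {0..}"
    using assms(1,2)
    by (intro absolutely_integrable_bounded_measurable_product_real)
      (auto intro!: boundedI[of _ B])
  then show ?thesis
    by (simp add: mult.commute)
qed

text \<open>By absolute integrability the Lebesgue integrals over \<open>{a..b}\<close> converge to
  the one over \<open>{a..}\<close>. They coincide with \<open>F b\<close>, so the two limits
  agree.\<close>

lemma has_integral_atLeast_absolutely:
  fixes f :: "real \<Rightarrow> real"
  assumes f: "f absolutely_integrable_on {a..}"
    and F: "\<And>b. b \<ge> a \<Longrightarrow> (f has_integral F b) {a..b}" and lim: "(F \<longlongrightarrow> l) at_top"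
  shows "(f has_integral l) {a..}"
proof -
  have "\<forall>\<^sub>F b in at_top. (LINT x:{a..b}|lebesgue. f x) = F b"
    using eventually_ge_at_top[of a]
  proof eventually_elim
    case (elim b)
    have "f absolutely_integrable_on {a..b}"
      using f by (rule set_integrable_subset) auto
    then show ?case
      using F[OF elim] by (simp add: set_lebesgue_integral_eq_integral(2) integral_unique)
  qed
  moreover have "((\<lambda>b. LINT x:{a..b}|lebesgue. f x) \<longlongrightarrow> (LINT x:{a..}|lebesgue. f x)) at_top"
    using f by (intro tendsto_set_lebesgue_integral_at_top) auto
  ultimately have "(F \<longlongrightarrow> (LINT x:{a..}|lebesgue. f x)) at_top"
    using tendsto_cong by fast
  then have "(LINT x:{a..}|lebesgue. f x) = l"
    using lim tendsto_unique trivial_limit_at_top_linorder by blast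
  then show ?thesis
    using has_integral_set_lebesgue[OF f] by simp
qed

text \<open>The integrand is almost everywhere the derivative of
  \<open>exp (- \<delta> * t) * S t\<close>, whose boundary term at infinity vanishes because skill
  is bounded. Keeping usage and skill in one integrand lets a multiple of this identity be
  subtracted from the payoff directly.\<close>

lemma admissible_plan_discounted_skill:
  assumes adm: "admissible_plan \<kappa> Sbar S0 u S" and "\<kappa> > 0" "\<delta> > 0" "Sbar > 0"
  shows "((\<lambda>t. exp (- \<delta> * t) * (\<kappa> * Sbar * (1 - u t) - (\<delta> + \<kappa>) * S t)) has_integral - S0) {0..}"
proof (rule has_integral_atLeast_absolutely)
  have range: "u t \<in> {0..1}" "S t \<in> {0..Sbar}" if "t \<ge> 0" for t
    using adm that unfolding admissible_plan_def by auto
  have [measurable]: "u \<in> borel_measurable (lebesgue_on {0..})"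
    using adm unfolding admissible_plan_def by blast
  have [measurable]: "S \<in> borel_measurable (lebesgue_on {0..})"
    using admissible_plan_skill_measurable[OF adm] assms by simp
  show "(\<lambda>t. exp (- \<delta> * t) * (\<kappa> * Sbar * (1 - u t) - (\<delta> + \<kappa>) * S t)) absolutely_integrable_on {0..}"
  proof (rule absolutely_integrable_exp_discount)
    fix t :: real assume "t \<ge> 0"
    \<comment> \<open>The bracket to be bounded is the drift minus
      \<open>\<delta> * S t\<close>.\<close>
    then have "\<bar>skill_drift \<kappa> Sbar (S t) (u t)\<bar> \<le> \<kappa> * Sbar" "\<bar>\<delta> * S t\<bar> \<le> \<delta> * Sbar"
      using range[of t] assms by (auto intro: abs_skill_drift_le simp: abs_mult)
    then show "\<bar>\<kappa> * Sbar * (1 - u t) - (\<delta> + \<kappa>) * S t\<bar> \<le> \<kappa> * Sbar + \<delta> * Sbar"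
      unfolding skill_drift_def distrib_right by linarith
  qed (use \<open>\<delta> > 0\<close> in measurable)
  show "((\<lambda>t. exp (- \<delta> * t) * (\<kappa> * Sbar * (1 - u t) - (\<delta> + \<kappa>) * S t))
          has_integral (exp (- \<delta> * b) * S b - S0)) {0..b}" if "b \<ge> 0" for b
    using admissible_plan_exp[OF adm _ that, of "- \<delta>"] \<open>\<kappa> > 0\<close>
    by (simp add: skill_drift_def algebra_simps)
  have "((\<lambda>b. exp (- \<delta> * b) * S b) \<longlongrightarrow> 0) at_top"
  proof (rule Lim_null_comparison)
    show "\<forall>\<^sub>F b in at_top. norm (exp (- \<delta> * b) * S b) \<le> exp (- \<delta> * b) * Sbar"
      using eventually_ge_at_top[of 0] by eventually_elim (use range in \<open>simp add: abs_mult\<close>)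
    show "((\<lambda>b. exp (- \<delta> * b) * Sbar) \<longlongrightarrow> 0) at_top"
      by (intro tendsto_mult_left_zero tendsto_exp_discount \<open>\<delta> > 0\<close>)
  qed
  then show "((\<lambda>b. exp (- \<delta> * b) * S b - S0) \<longlongrightarrow> - S0) at_top"
    by (auto intro: tendsto_eq_intros)
qed

lemma admissible_plan_full_automation:
  assumes "\<kappa> > 0" "S0 \<in> {0..Sbar}"
  shows "admissible_plan \<kappa> Sbar S0 (\<lambda>t. 1) (\<lambda>t. S0 * exp (- \<kappa> * t))"
  unfolding admissible_plan_def
proof (intro conjI allI impI)
  fix t :: real assume "t \<ge> 0"
  have "S0 * exp (- \<kappa> * t) \<le> S0"
    using assms \<open>t \<ge> 0\<close> by (auto intro: mult_left_le)
  then show "S0 * exp (- \<kappa> * t) \<in> {0..Sbar}"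
    using assms unfolding atLeastAtMost_iff by (auto intro: order_trans)
  have "((\<lambda>s. - \<kappa> * (S0 * exp (- \<kappa> * s))) has_integral
          (S0 * exp (- \<kappa> * t) - S0 * exp (- \<kappa> * 0))) {0..t}"
    using \<open>t \<ge> 0\<close> by (intro fundamental_theorem_of_calculus)
      (auto simp flip: has_real_derivative_iff_has_vector_derivative intro!: derivative_eq_intros)
  then show "((\<lambda>s. skill_drift \<kappa> Sbar (S0 * exp (- \<kappa> * s)) 1) has_integral
          (S0 * exp (- \<kappa> * t) - S0)) {0..t}"
    by (simp add: skill_drift_def)
qed auto

text \<open>Where \<open>u s = 1\<close> the drift is \<open>- \<kappa> * S s\<close>, so the
  integrand of \<open>admissible_plan_exp\<close> with \<open>c = \<kappa>\<close> vanishes. Since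
  the law of motion is integrated, an almost everywhere condition on usage fixes skill at every
  time.\<close>

lemma AE_full_automation_skill:
  assumes adm: "admissible_plan \<kappa> Sbar S0 u S" and "\<kappa> > 0" "t \<ge> 0"
    and u: "AE t in lebesgue_on {0..}. u t = 1"
  shows "S t = S0 * exp (- \<kappa> * t)"
proof -
  have "AE s in lborel. s \<in> {0..t} \<longrightarrow>
      exp (\<kappa> * s) * (skill_drift \<kappa> Sbar (S s) (u s) + \<kappa> * S s) = 0"
    using u by (auto simp: AE_restrict_space_iff AE_completion_iff skill_drift_def)
  from iffD1[OF has_integral_AE[OF this] admissible_plan_exp[OF adm]]
  have "((\<lambda>s. 0) has_integral (exp (\<kappa> * t) * S t - S0)) {0..t}"
    using assms by simp
  then have "exp (\<kappa> * t) * S t = S0"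
    by (simp add: has_integral_iff)
  then show ?thesis
    by (auto simp: exp_minus)
qed

section \<open>Payoff shortfall and value function above the threshold\<close>

text \<open>At \<beta> = 1 the complementarity term \<open>S * u\<close> exactly offsets the skill
  displaced by AI, which separates skill from usage.\<close>

lemma productivity_unit_complementarity:
  "productivity \<alpha> 1 \<gamma> S u = S + \<alpha> * u - \<gamma> * u\<^sup>2"
  by (simp add: productivity_def algebra_simps power2_eq_square)

locale full_automation_regime =
  fixes \<alpha> \<gamma> \<kappa> \<delta> Sbar :: real
  assumes pos: "\<alpha> > 0" "\<gamma> > 0" "\<kappa> > 0" "\<delta> > 0" "Sbar > 0"
    and threshold: "2 * \<gamma> + \<kappa> * Sbar / (\<delta> + \<kappa>) \<le> \<alpha>"
begin

text \<open>
  The flow loss of using \<open>u\<close> instead of \<open>1\<close>, when skill is priced at its discounted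
  marginal value \<open>1 / (\<delta> + \<kappa>)\<close>.
\<close>
definition loss :: "real \<Rightarrow> real" where
  "loss u = (1 - u) * (\<alpha> - \<kappa> * Sbar / (\<delta> + \<kappa>) - \<gamma> * (1 + u))"

text \<open>This is the payoff of constant usage 1: skill decays at rate \<kappa> and is discounted
  at rate \<delta>, while the remaining flow \<open>\<alpha> - \<gamma>\<close> is a
  perpetuity.\<close>

definition automation_value :: "real \<Rightarrow> real" where
  "automation_value S = S / (\<delta> + \<kappa>) + (\<alpha> - \<gamma>) / \<delta>"

lemma gamma_less_alpha: "\<gamma> < \<alpha>"
proof -
  have "0 < \<kappa> * Sbar / (\<delta> + \<kappa>)"
    using pos by simp
  then show ?thesis
    using threshold pos by linarith
qed

text \<open>The threshold makes the second factor of \<open>loss u\<close> at least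
  \<open>2 * \<gamma> - \<gamma> * (1 + u) = \<gamma> * (1 - u)\<close>. The bound is strictly
  positive for \<open>u < 1\<close> even at the threshold itself, so uniqueness of the optimum
  extends to that case.\<close>

lemma loss_ge: "\<gamma> * (1 - u)\<^sup>2 \<le> loss u" if "u \<le> 1"
proof -
  have "(1 - u) * (\<gamma> * (1 - u)) \<le> loss u"
    unfolding loss_def using that threshold by (intro mult_left_mono) (auto simp: algebra_simps)
  then show ?thesis
    by (simp add: power2_eq_square mult_ac)
qed

lemma loss_nonneg: "0 \<le> loss u" if "u \<le> 1"
proof -
  have "0 \<le> \<gamma> * (1 - u)\<^sup>2"
    using pos by simp
  then show ?thesis
    using loss_ge[OF that] by linarith
qed

lemma loss_eq_0_iff: "loss u = 0 \<longleftrightarrow> u = 1" if "u \<le> 1"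
proof
  assume "loss u = 0"
  then show "u = 1"
    using loss_ge[OF that] pos by (simp add: mult_le_0_iff)
qed (simp add: loss_def)

text \<open>The loss is the defect in the Bellman equation for the candidate value
  \<open>automation_value\<close>, whose slope is \<open>1 / (\<delta> + \<kappa>)\<close>.\<close>

lemma bellman_objective_eq:
  "bellman_objective \<alpha> 1 \<gamma> \<kappa> Sbar (1 / (\<delta> + \<kappa>)) S u = \<delta> * automation_value S - loss u"
proof -
  define q where "q = 1 / (\<delta> + \<kappa>)"
  \<comment> \<open>With \<open>q\<close> in place of the fraction the claim becomes polynomial; the
    relation \<open>q * (\<delta> + \<kappa>) = 1\<close> enters through this multiple by
    \<open>S\<close>.\<close>
  have "S = (q * (\<delta> + \<kappa>)) * S"
    using pos by (simp add: q_def)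
  then have "S = q * \<delta> * S + q * \<kappa> * S"
    by (simp add: algebra_simps)
  moreover have "\<delta> * automation_value S = q * \<delta> * S + (\<alpha> - \<gamma>)"
    using pos by (simp add: automation_value_def q_def distrib_left)
  moreover have "loss u = (1 - u) * (\<alpha> - q * \<kappa> * Sbar - \<gamma> * (1 + u))"
    by (simp add: loss_def q_def)
  ultimately show ?thesis
    unfolding bellman_objective_def productivity_unit_complementarity skill_drift_def q_def[symmetric]
    by (simp add: algebra_simps power2_eq_square)
qed

text \<open>This is the verification identity: the shortfall of any plan from the candidate value is
  its discounted loss. It combines the perpetuity of \<open>\<alpha> - \<gamma>\<close>, the payoff
  and the discounted law of motion.\<close>

lemma has_integral_loss:
  assumes adm: "admissible_plan \<kappa> Sbar S0 u S"
  shows "(\<lambda>t. exp (- \<delta> * t) * loss (u t)) absolutely_integrable_on {0..}"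
    and "((\<lambda>t. exp (- \<delta> * t) * loss (u t)) has_integral
            (automation_value S0 - payoff \<alpha> 1 \<gamma> \<delta> u S)) {0..}"
proof -
  have range: "u t \<in> {0..1}" "S t \<in> {0..Sbar}" if "t \<ge> 0" for t
    using adm that unfolding admissible_plan_def by auto
  have [measurable]: "u \<in> borel_measurable (lebesgue_on {0..})"
    using adm unfolding admissible_plan_def by blast
  have [measurable]: "S \<in> borel_measurable (lebesgue_on {0..})"
    using admissible_plan_skill_measurable[OF adm] pos by simp
  define p where "p t = productivity \<alpha> 1 \<gamma> (S t) (u t)" for t
  have "(\<lambda>t. exp (- \<delta> * t) * p t) absolutely_integrable_on {0..}"
  proof (rule absolutely_integrable_exp_discount)
    fix t :: real assume "t \<ge> 0"
    have "\<bar>\<alpha> * u t\<bar> \<le> \<alpha>" "\<bar>\<gamma> * (u t)\<^sup>2\<bar> \<le> \<gamma>" "\<bar>S t\<bar> \<le> Sbar"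
      using range[OF \<open>t \<ge> 0\<close>] pos by (auto simp: abs_mult power_le_one intro!: mult_left_le)
    then show "\<bar>p t\<bar> \<le> Sbar + \<alpha> + \<gamma>"
      unfolding p_def productivity_unit_complementarity by linarith
  qed (use pos in \<open>simp_all add: p_def productivity_unit_complementarity\<close>)
  then have payoff: "((\<lambda>t. exp (- \<delta> * t) * p t) has_integral payoff \<alpha> 1 \<gamma> \<delta> u S) {0..}"
    unfolding payoff_def p_def
    using integrable_integral set_lebesgue_integral_eq_integral(1) by blast
  have const: "((\<lambda>t. exp (- \<delta> * t) * (\<alpha> - \<gamma>)) has_integral (1 / \<delta> * (\<alpha> - \<gamma>))) {0..}"
    using has_integral_exp_minus_to_infinity[of \<delta> 0] pos
    by (intro has_integral_mult_left) simp
  have skill: "((\<lambda>t. 1 / (\<delta> + \<kappa>) * (exp (- \<delta> * t) * (\<kappa> * Sbar * (1 - u t) - (\<delta> + \<kappa>) * S t)))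
      has_integral (1 / (\<delta> + \<kappa>) * - S0)) {0..}"
    by (intro has_integral_mult_right admissible_plan_discounted_skill adm pos)
  have "\<delta> + \<kappa> \<noteq> 0"
    using pos by linarith
  \<comment> \<open>The weight \<open>1 / (\<delta> + \<kappa>)\<close> on the law of motion is the
    one that cancels \<open>S t\<close>.\<close>
  then have "exp (- \<delta> * t) * (\<alpha> - \<gamma>) - exp (- \<delta> * t) * p t
      - 1 / (\<delta> + \<kappa>) * (exp (- \<delta> * t) * (\<kappa> * Sbar * (1 - u t) - (\<delta> + \<kappa>) * S t))
      = exp (- \<delta> * t) * loss (u t)" for t
    unfolding p_def productivity_unit_complementarity loss_def
    by (simp add: field_simps power2_eq_square)
  then show int: "((\<lambda>t. exp (- \<delta> * t) * loss (u t)) has_integral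
      (automation_value S0 - payoff \<alpha> 1 \<gamma> \<delta> u S)) {0..}"
    using has_integral_diff[OF has_integral_diff[OF const payoff] skill]
    by (simp add: automation_value_def algebra_simps)
  have "0 \<le> exp (- \<delta> * t) * loss (u t)" if "t \<in> {0..}" for t
    using range[of t] loss_nonneg[of "u t"] that by simp
  then show "(\<lambda>t. exp (- \<delta> * t) * loss (u t)) absolutely_integrable_on {0..}"
    using int by (intro nonnegative_absolutely_integrable_1) auto
qed

lemma payoff_le:
  assumes adm: "admissible_plan \<kappa> Sbar S0 u S"
  shows "payoff \<alpha> 1 \<gamma> \<delta> u S \<le> automation_value S0"
proof -
  have "0 \<le> exp (- \<delta> * t) * loss (u t)" if "t \<in> {0..}" for t
    using adm loss_nonneg[of "u t"] that unfolding admissible_plan_def by auto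
  from has_integral_nonneg[OF has_integral_loss(2)[OF adm] this] show ?thesis
    by simp
qed

text \<open>A nonnegative integrable function with integral 0 vanishes almost everywhere, and the
  loss vanishes only at usage 1.\<close>

lemma payoff_eq_iff:
  assumes adm: "admissible_plan \<kappa> Sbar S0 u S"
  shows "payoff \<alpha> 1 \<gamma> \<delta> u S = automation_value S0 \<longleftrightarrow> (AE t in lebesgue_on {0..}. u t = 1)"
proof -
  have u: "u t \<le> 1" if "t \<ge> 0" for t
    using adm that unfolding admissible_plan_def by auto
  have int: "integrable (lebesgue_on {0..}) (\<lambda>t. exp (- \<delta> * t) * loss (u t))"
    using has_integral_loss(1)[OF adm] by (rule absolutely_integrable_imp_integrable) simp
  have nonneg: "AE t in lebesgue_on {0..}. 0 \<le> exp (- \<delta> * t) * loss (u t)"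
    using u loss_nonneg by (intro AE_I2) simp
  have "payoff \<alpha> 1 \<gamma> \<delta> u S = automation_value S0 \<longleftrightarrow>
      integral\<^sup>L (lebesgue_on {0..}) (\<lambda>t. exp (- \<delta> * t) * loss (u t)) = 0"
    using lebesgue_integral_eq_integral[OF int] integral_unique[OF has_integral_loss(2)[OF adm]]
    by auto
  also have "\<dots> \<longleftrightarrow> (AE t in lebesgue_on {0..}. exp (- \<delta> * t) * loss (u t) = 0)"
    by (rule integral_nonneg_eq_0_iff_AE[OF int nonneg])
  also have "\<dots> \<longleftrightarrow> (AE t in lebesgue_on {0..}. u t = 1)"
    using u by (intro AE_cong) (auto simp: loss_eq_0_iff)
  finally show ?thesis .
qed

lemma optimal_plan_iff:
  "optimal_plan \<alpha> 1 \<gamma> \<kappa> \<delta> Sbar S0 u S \<longleftrightarrow>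
     admissible_plan \<kappa> Sbar S0 u S \<and> (AE t in lebesgue_on {0..}. u t = 1)"
proof (cases "admissible_plan \<kappa> Sbar S0 u S")
  case True
  then have full: "admissible_plan \<kappa> Sbar S0 (\<lambda>t. 1) (\<lambda>t. S0 * exp (- \<kappa> * t))"
    using admissible_plan_full_automation admissible_plan_start(2) pos by blast
  \<comment> \<open>No integral is evaluated: constant usage 1 has zero loss, so it attains the
    upper bound. Optimality of a plan thereby reduces to attaining
    \<open>automation_value S0\<close>.\<close>
  then have "payoff \<alpha> 1 \<gamma> \<delta> (\<lambda>t. 1) (\<lambda>t. S0 * exp (- \<kappa> * t)) = automation_value S0"
    by (simp add: payoff_eq_iff)
  then have "optimal_plan \<alpha> 1 \<gamma> \<kappa> \<delta> Sbar S0 u S \<longleftrightarrow> payoff \<alpha> 1 \<gamma> \<delta> u S = automation_value S0"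
    unfolding optimal_plan_def using True full payoff_le by (metis order_antisym)
  then show ?thesis
    using True payoff_eq_iff by blast
qed (simp add: optimal_plan_def)

lemma skill_value_eq:
  assumes "S0 \<in> {0..Sbar}"
  shows "skill_value \<alpha> 1 \<gamma> \<kappa> \<delta> Sbar S0 = automation_value S0"
  unfolding skill_value_def
proof (rule cSup_eq_maximum)
  have full: "admissible_plan \<kappa> Sbar S0 (\<lambda>t. 1) (\<lambda>t. S0 * exp (- \<kappa> * t))"
    using pos(3) assms by (rule admissible_plan_full_automation)
  then have "payoff \<alpha> 1 \<gamma> \<delta> (\<lambda>t. 1) (\<lambda>t. S0 * exp (- \<kappa> * t)) = automation_value S0"
    by (simp add: payoff_eq_iff)
  then show "automation_value S0 \<in> {payoff \<alpha> 1 \<gamma> \<delta> u S | u S. admissible_plan \<kappa> Sbar S0 u S}"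
    using full by (auto intro!: exI)
qed (auto intro: payoff_le)

section \<open>Optimal feedback policies\<close>

text \<open>The slope \<open>D\<close> in \<open>optimal_policy\<close> is existentially quantified.
  Derivatives within a nondegenerate closed interval are unique, also at its endpoints, so only the
  shadow price can occur.\<close>

lemma skill_value_has_derivative_iff:
  assumes "S \<in> {0..Sbar}"
  shows "(skill_value \<alpha> 1 \<gamma> \<kappa> \<delta> Sbar has_real_derivative D) (at S within {0..Sbar}) \<longleftrightarrow>
    D = 1 / (\<delta> + \<kappa>)"
proof -
  have "(automation_value has_real_derivative 1 / (\<delta> + \<kappa>)) (at S within {0..Sbar})"
    unfolding automation_value_def[abs_def]
    using DERIV_add[OF DERIV_cdivide[OF DERIV_ident] DERIV_const] by simp
  then have der: "(skill_value \<alpha> 1 \<gamma> \<kappa> \<delta> Sbar has_real_derivative 1 / (\<delta> + \<kappa>)) (at S within {0..Sbar})"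
    by (rule has_field_derivative_transform_within[OF _ zero_less_one assms]) (simp add: skill_value_eq)
  moreover have "D = 1 / (\<delta> + \<kappa>)"
    if "(skill_value \<alpha> 1 \<gamma> \<kappa> \<delta> Sbar has_real_derivative D) (at S within {0..Sbar})"
    using that der pos assms unfolding has_real_derivative_iff_has_vector_derivative
    by (intro vector_derivative_unique_within_closed_interval[of 0 Sbar S]) auto
  ultimately show ?thesis
    by auto
qed

text \<open>By \<open>bellman_objective_eq\<close> the Bellman equation at \<open>v\<close> says
  \<open>loss v = 0\<close>, hence \<open>v = 1\<close>; conversely 1 is a maximizer because the
  loss is nonnegative on \<open>{0..1}\<close>.\<close>

lemma optimal_policy_iff:
  "optimal_policy \<alpha> 1 \<gamma> \<kappa> \<delta> Sbar ustar \<longleftrightarrow> (\<forall>S\<in>{0..Sbar}. ustar S = 1)"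
proof -
  have "is_arg_max (bellman_objective \<alpha> 1 \<gamma> \<kappa> Sbar (1 / (\<delta> + \<kappa>)) S) (\<lambda>u. u \<in> {0..1}) v \<and>
      \<delta> * skill_value \<alpha> 1 \<gamma> \<kappa> \<delta> Sbar S = bellman_objective \<alpha> 1 \<gamma> \<kappa> Sbar (1 / (\<delta> + \<kappa>)) S v
      \<longleftrightarrow> v = 1" if "S \<in> {0..Sbar}" for S v
    using loss_eq_0_iff[of v] loss_eq_0_iff[of 1]
    by (auto simp: is_arg_max_def bellman_objective_eq skill_value_eq[OF that] not_less
        intro: loss_nonneg)
  then show ?thesis
    unfolding optimal_policy_def by (auto simp: skill_value_has_derivative_iff)
qed

end

section \<open>Comparison with the no-AI benchmark\<close>

theorem proposition2:
  fixes \<alpha> \<beta> \<gamma> \<kappa> \<delta> Sbar \<alpha>2 \<alpha>3 :: real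
    and V :: "real \<Rightarrow> real"
  assumes "\<alpha> > 0" "\<gamma> > 0" "\<kappa> > 0" "\<delta> > 0" "Sbar > 0"
    and "\<beta> = 1"
    and "\<alpha>2 = 2 * \<gamma> + \<kappa> * Sbar / (\<delta> + \<kappa>)"
    and "\<alpha>3 = \<gamma> + Sbar"
    and "\<alpha> \<ge> \<alpha>2"
    and "V = skill_value \<alpha> \<beta> \<gamma> \<kappa> \<delta> Sbar"
  shows
    "(\<forall>ustar. optimal_policy \<alpha> \<beta> \<gamma> \<kappa> \<delta> Sbar ustar \<longleftrightarrow> (\<forall>S\<in>{0..Sbar}. ustar S = 1)) \<and>
     (\<forall>S0\<in>{0..Sbar}. \<exists>S. optimal_plan \<alpha> \<beta> \<gamma> \<kappa> \<delta> Sbar S0 (\<lambda>t. 1) S) \<and>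
     (\<forall>S0 u S. optimal_plan \<alpha> \<beta> \<gamma> \<kappa> \<delta> Sbar S0 u S \<longrightarrow>
        (AE t in lebesgue_on {0..}. u t = 1)) \<and>
     (\<forall>ustar. optimal_policy \<alpha> \<beta> \<gamma> \<kappa> \<delta> Sbar ustar \<longrightarrow>
        (\<exists>!Shat. steady_skill \<kappa> Sbar ustar Shat)) \<and>
     (\<forall>ustar Shat.
        optimal_policy \<alpha> \<beta> \<gamma> \<kappa> \<delta> Sbar ustar \<and> steady_skill \<kappa> Sbar ustar Shat \<longrightarrow>
        (\<alpha>2 \<le> \<alpha> \<and> \<alpha> < \<alpha>3 \<longrightarrow>
           (\<forall>S0 u S. optimal_plan \<alpha> \<beta> \<gamma> \<kappa> \<delta> Sbar S0 u S \<longrightarrow> (S \<longlongrightarrow> 0) at_top) \<and>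
           Shat = 0 \<and>
           (\<forall>S\<in>{0..Sbar}. productivity \<alpha> \<beta> \<gamma> S 0 = S \<and>
              productivity \<alpha> \<beta> \<gamma> S (ustar S) > productivity \<alpha> \<beta> \<gamma> S 0) \<and>
           V Shat < Sbar / \<delta>) \<and>
        (\<alpha> = \<alpha>3 \<longrightarrow> V Shat = Sbar / \<delta>) \<and>
        (\<alpha> > max \<alpha>2 \<alpha>3 \<longrightarrow>
           (\<forall>S\<in>{0..Sbar}. productivity \<alpha> \<beta> \<gamma> S 0 = S \<and>
              productivity \<alpha> \<beta> \<gamma> S (ustar S) > productivity \<alpha> \<beta> \<gamma> S 0) \<and>
           V Shat > Sbar / \<delta>))"
proof -
  interpret full_automation_regime \<alpha> \<gamma> \<kappa> \<delta> Sbar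
    using assms by unfold_locales auto
  \<comment> \<open>Under full automation the drift at \<open>Shat\<close> is
    \<open>- \<kappa> * Shat\<close>.\<close>
  have steady: "steady_skill \<kappa> Sbar ustar Shat \<longleftrightarrow> Shat = 0"
    if "optimal_policy \<alpha> 1 \<gamma> \<kappa> \<delta> Sbar ustar" for ustar Shat
    using that pos unfolding steady_skill_def optimal_policy_iff skill_drift_def by auto
  have V0: "V 0 = (\<alpha> - \<gamma>) / \<delta>"
    using pos by (simp add: assms(6,10) skill_value_eq automation_value_def)
  have erosion: "(S \<longlongrightarrow> 0) at_top" if "optimal_plan \<alpha> 1 \<gamma> \<kappa> \<delta> Sbar S0 u S" for S0 u S
  proof -
    \<comment> \<open>Admissibility constrains the path at nonnegative times only, so the
      exponential formula is claimed eventually.\<close>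
    have "\<forall>\<^sub>F t in at_top. S t = S0 * exp (- \<kappa> * t)"
      using eventually_ge_at_top[of 0]
      by eventually_elim (use that pos AE_full_automation_skill in \<open>auto simp: optimal_plan_iff\<close>)
    then show ?thesis
      using tendsto_mult_right_zero[OF tendsto_exp_discount[OF pos(3)]] tendsto_cong by fast
  qed
  \<comment> \<open>The short-run gain is \<open>\<alpha> - \<gamma>\<close> at every skill
    level.\<close>
  have flow: "productivity \<alpha> 1 \<gamma> S 0 = S \<and>
      productivity \<alpha> 1 \<gamma> S (ustar S) > productivity \<alpha> 1 \<gamma> S 0"
    if "optimal_policy \<alpha> 1 \<gamma> \<kappa> \<delta> Sbar ustar" "S \<in> {0..Sbar}" for ustar S
    using that gamma_less_alpha
    by (simp add: optimal_policy_iff productivity_unit_complementarity)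
  have plan: "\<exists>S. optimal_plan \<alpha> 1 \<gamma> \<kappa> \<delta> Sbar S0 (\<lambda>t. 1) S" if "S0 \<in> {0..Sbar}" for S0
    using admissible_plan_full_automation[OF pos(3) that] by (auto simp: optimal_plan_iff)
  \<comment> \<open>The gap \<open>V 0 - Sbar / \<delta>\<close> equals
    \<open>(\<alpha> - \<alpha>3) / \<delta>\<close>, so its sign is that of
    \<open>\<alpha> - \<alpha>3\<close>.\<close>
  have long_run: "V 0 < Sbar / \<delta> \<longleftrightarrow> \<alpha> < \<alpha>3" "V 0 = Sbar / \<delta> \<longleftrightarrow> \<alpha> = \<alpha>3"
    "V 0 > Sbar / \<delta> \<longleftrightarrow> \<alpha> > \<alpha>3"
    using pos unfolding V0 assms(8) divide_less_cancel divide_cancel_right by auto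
  show ?thesis
    unfolding \<open>\<beta> = 1\<close>
  proof (intro conjI allI impI; (elim conjE)?)
    fix ustar
    show "optimal_policy \<alpha> 1 \<gamma> \<kappa> \<delta> Sbar ustar \<longleftrightarrow> (\<forall>S\<in>{0..Sbar}. ustar S = 1)"
      by (rule optimal_policy_iff)
    show "\<exists>!Shat. steady_skill \<kappa> Sbar ustar Shat" if "optimal_policy \<alpha> 1 \<gamma> \<kappa> \<delta> Sbar ustar"
      using steady[OF that] by simp
  next
    show "\<forall>S0\<in>{0..Sbar}. \<exists>S. optimal_plan \<alpha> 1 \<gamma> \<kappa> \<delta> Sbar S0 (\<lambda>t. 1) S"
      using plan by blast
    show "AE t in lebesgue_on {0..}. u t = 1" if "optimal_plan \<alpha> 1 \<gamma> \<kappa> \<delta> Sbar S0 u S" for S0 u S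
      using that by (simp add: optimal_plan_iff)
  next
    fix ustar Shat
    assume opt: "optimal_policy \<alpha> 1 \<gamma> \<kappa> \<delta> Sbar ustar" and "steady_skill \<kappa> Sbar ustar Shat"
    then have [simp]: "Shat = 0"
      using steady by blast
    show "Shat = 0" by simp
    show "\<forall>S\<in>{0..Sbar}. productivity \<alpha> 1 \<gamma> S 0 = S \<and>
        productivity \<alpha> 1 \<gamma> S 0 < productivity \<alpha> 1 \<gamma> S (ustar S)"
      "\<forall>S\<in>{0..Sbar}. productivity \<alpha> 1 \<gamma> S 0 = S \<and>
        productivity \<alpha> 1 \<gamma> S 0 < productivity \<alpha> 1 \<gamma> S (ustar S)"
      using flow[OF opt] by blast+
    show "(S \<longlongrightarrow> 0) at_top" if "optimal_plan \<alpha> 1 \<gamma> \<kappa> \<delta> Sbar S0 u S" for S0 u S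
      using erosion[OF that] .
    show "V Shat < Sbar / \<delta>" if "\<alpha> < \<alpha>3"
      using that long_run by simp
    show "V Shat = Sbar / \<delta>" if "\<alpha> = \<alpha>3"
      using that long_run by simp
    show "Sbar / \<delta> < V Shat" if "max \<alpha>2 \<alpha>3 < \<alpha>"
      using that long_run by simp
  qed
qed

end
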